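(* Let $\lambda$ be a regular cardinal, let $\mathcal A$ be a $\lambda$-mono-generated category, let $\mathcal B$ be a category, and let $F:\mathcal A\to\mathcal B$ be a functor preserving monomorphisms and $\lambda$-directed colimits of monomorphisms. If $X,Y$ are objects of $\mathcal A$ with $X\sim_\lambda Y$ in $\mathcal A$, then $F(X)\sim_\lambda F(Y)$ in $\mathcal B$.
   Context: Regular cardinals are infinite. A $\lambda$-directed diagram is a functor whose domain is a $\lambda$-directed poset (every subset of cardinality $<\lambda$ has an upper bound); a $\lambda$-directed colimit of monomorphisms is a colimit of a $\lambda$-directed diagram all of whose maps are monomorphisms. A functor is said to preserve $\lambda$-directed colimits of monomorphisms if it preserves those that exist in its domain. An object $G$ of a category $\mathcal A$ is $\lambda$-generated if $\hom(G,-):\mathcal A\to \mathrm{Set}$ preserves those $\lambda$-directed colimits of monomorphisms that exist in $\mathcal A$. The category $\mathcal A$ is $\lambda$-mono-generated if every object of $\mathcal A$ is a colimit of a $\lambda$-directed diagram consisting of monomorphisms and $\lambda$-generated objects. (It is not assumed that all $\lambda$-directed colimits of monomorphisms exist.) A span between objects $X,Y$ is a diagram $X\xleftarrow{x}U\xrightarrow{y}Y$ with both $x,y$ monomorphisms. A set $\{X\xleftarrow{x_i}U_i\xrightarrow{y_i}Y \mid i\in I\}$ of spans is $\lambda$-dense if it is non-empty and: (back) for all $i\in I$ and every monomorphism $g:G\to X$ with $G$ $\lambda$-generated, there exist $j\in I$ and morphisms $s:G\to U_j$, $w:U_i\to U_j$ with $x_js=g$, $x_jw=x_i$, $y_jw=y_i$;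 (forth) for all $i\in I$ and every monomorphism $g:G\to Y$ with $G$ $\lambda$-generated, there exist $j\in I$ and morphisms $s:G\to U_j$, $w:U_i\to U_j$ with $y_js=g$, $x_jw=x_i$, $y_jw=y_i$. Objects $X,Y$ are $\lambda$-equivalent, written $X\sim_\lambda Y$, if there exists a $\lambda$-dense set of spans between $X$ and $Y$. *)

theory Defs
  imports Main "HOL-Library.FuncSet"
begin

unbundle cardinal_syntax

section \<open>Categories and functors\<close>

record ('o, 'm) cat =
  Obj :: "'o set"
  Arr :: "'m set"
  Dom :: "'m \<Rightarrow> 'o"
  Cod :: "'m \<Rightarrow> 'o"
  Ident :: "'o \<Rightarrow> 'm"
  Comp :: "'m \<Rightarrow> 'm \<Rightarrow> 'm"  \<comment> \<open>\<open>Comp C g f\<close> is \<open>g\<close> after \<open>f\<close>\<close>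

definition hom :: "('o, 'm) cat \<Rightarrow> 'o \<Rightarrow> 'o \<Rightarrow> 'm set" where
  "hom C X Y = {f \<in> Arr C. Dom C f = X \<and> Cod C f = Y}"

locale category =
  fixes C :: "('o, 'm) cat"
  assumes Dom_in_Obj: "f \<in> Arr C \<Longrightarrow> Dom C f \<in> Obj C"
    and Cod_in_Obj: "f \<in> Arr C \<Longrightarrow> Cod C f \<in> Obj C"
    and Ident_in_hom: "X \<in> Obj C \<Longrightarrow> Ident C X \<in> hom C X X"
    and Comp_in_hom: "f \<in> hom C X Y \<Longrightarrow> g \<in> hom C Y Z \<Longrightarrow> Comp C g f \<in> hom C X Z"
    and Comp_Ident: "f \<in> Arr C \<Longrightarrow> Comp C f (Ident C (Dom C f)) = f"
    and Ident_Comp: "f \<in> Arr C \<Longrightarrow> Comp C (Ident C (Cod C f)) f = f"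
    and Comp_assoc: "f \<in> hom C W X \<Longrightarrow> g \<in> hom C X Y \<Longrightarrow> h \<in> hom C Y Z \<Longrightarrow>
      Comp C h (Comp C g f) = Comp C (Comp C h g) f"

definition monic :: "('o, 'm) cat \<Rightarrow> 'm \<Rightarrow> bool" where
  "monic C f \<longleftrightarrow> f \<in> Arr C \<and>
    (\<forall>T \<in> Obj C. \<forall>g \<in> hom C T (Dom C f). \<forall>h \<in> hom C T (Dom C f).
      Comp C f g = Comp C f h \<longrightarrow> g = h)"

record ('o, 'm, 'p, 'n) fnctr =
  omap :: "'o \<Rightarrow> 'p"
  amap :: "'m \<Rightarrow> 'n"

locale is_functor = dom: category C + cod: category D
  for C :: "('o, 'm) cat" and D :: "('p, 'n) cat" +
  fixes F :: "('o, 'm, 'p, 'n) fnctr"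
  assumes omap_in_Obj: "X \<in> Obj C \<Longrightarrow> omap F X \<in> Obj D"
    and amap_in_hom: "f \<in> hom C X Y \<Longrightarrow> amap F f \<in> hom D (omap F X) (omap F Y)"
    and amap_Ident: "X \<in> Obj C \<Longrightarrow> amap F (Ident C X) = Ident D (omap F X)"
    and amap_Comp: "f \<in> hom C X Y \<Longrightarrow> g \<in> hom C Y Z \<Longrightarrow>
      amap F (Comp C g f) = Comp D (amap F g) (amap F f)"

definition comp_functor ::
    "('p, 'n, 'q, 'k) fnctr \<Rightarrow> ('o, 'm, 'p, 'n) fnctr \<Rightarrow> ('o, 'm, 'q, 'k) fnctr" where
  "comp_functor G F = \<lparr>omap = omap G \<circ> omap F, amap = amap G \<circ> amap F\<rparr>"

definition preserves_monos ::
    "('o, 'm) cat \<Rightarrow> ('p, 'n) cat \<Rightarrow> ('o, 'm, 'p, 'n) fnctr \<Rightarrow> bool" where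
  "preserves_monos A B F \<longleftrightarrow> (\<forall>f. monic A f \<longrightarrow> monic B (amap F f))"


section \<open>Colimits\<close>

definition is_cocone :: "('i, 'a) cat \<Rightarrow> ('o, 'm) cat \<Rightarrow> ('i, 'a, 'o, 'm) fnctr \<Rightarrow>
    'o \<Rightarrow> ('i \<Rightarrow> 'm) \<Rightarrow> bool" where
  "is_cocone J C D X c \<longleftrightarrow> X \<in> Obj C \<and>
    (\<forall>j \<in> Obj J. c j \<in> hom C (omap D j) X) \<and>
    (\<forall>a \<in> Arr J. Comp C (c (Cod J a)) (amap D a) = c (Dom J a))"

definition is_colimit :: "('i, 'a) cat \<Rightarrow> ('o, 'm) cat \<Rightarrow> ('i, 'a, 'o, 'm) fnctr \<Rightarrow>
    'o \<Rightarrow> ('i \<Rightarrow> 'm) \<Rightarrow> bool" where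
  "is_colimit J C D X c \<longleftrightarrow> is_cocone J C D X c \<and>
    (\<forall>Y d. is_cocone J C D Y d \<longrightarrow>
      (\<exists>!h. h \<in> hom C X Y \<and> (\<forall>j \<in> Obj J. Comp C h (c j) = d j)))"


section \<open>Directed diagrams of monomorphisms\<close>

definition regular_cardinal :: "'l rel \<Rightarrow> bool" where
  "regular_cardinal lam \<longleftrightarrow> Cinfinite lam \<and> regularCard lam"

text \<open>
  A poset is represented by its (reflexive) order relation \<open>r\<close>, with carrier \<open>Field r\<close>.
\<close>

definition directed_poset :: "'l rel \<Rightarrow> 'u rel \<Rightarrow> bool" where
  "directed_poset lam r \<longleftrightarrow> Partial_order r \<and>
    (\<forall>S \<subseteq> Field r. |S| <o lam \<longrightarrow> (\<exists>u \<in> Field r. \<forall>s \<in> S. (s, u) \<in> r))"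

definition poset_cat :: "'u rel \<Rightarrow> ('u, 'u \<times> 'u) cat" where
  "poset_cat r = \<lparr>Obj = Field r, Arr = r, Dom = fst, Cod = snd,
    Ident = (\<lambda>p. (p, p)), Comp = (\<lambda>b a. (fst a, snd b))\<rparr>"

text \<open>
  Categories may be large, whereas diagrams and sets of spans are sets.  The
  distinction is made by a cardinal \<open>\<kappa>\<close> on a type \<open>'u\<close>: a set is \<^emph>\<open>small\<close> if its
  cardinality is less than \<open>\<kappa>\<close>.  Every small poset is isomorphic to one whose carrier
  is a subset of \<open>'u\<close>, so it suffices to index diagrams by posets on \<open>'u\<close>.
  If \<open>'u\<close> is a universe of sets and \<open>\<kappa>\<close> is the cardinality of that universe, then
  smallness is sethood.
\<close>

definition mono_diagram :: "'u rel \<Rightarrow> 'l rel \<Rightarrow> ('o, 'm) cat \<Rightarrow> 'u rel \<Rightarrow>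
    ('u, 'u \<times> 'u, 'o, 'm) fnctr \<Rightarrow> bool" where
  "mono_diagram \<kappa> lam A r D \<longleftrightarrow> directed_poset lam r \<and> |Field r| <o \<kappa> \<and>
    is_functor (poset_cat r) A D \<and> (\<forall>a \<in> Arr (poset_cat r). monic A (amap D a))"

definition preserves_mono_colimits :: "'u rel \<Rightarrow> 'l rel \<Rightarrow> ('o, 'm) cat \<Rightarrow> ('p, 'n) cat \<Rightarrow>
    ('o, 'm, 'p, 'n) fnctr \<Rightarrow> bool" where
  "preserves_mono_colimits \<kappa> lam A B F \<longleftrightarrow>
    (\<forall>r D X c. mono_diagram \<kappa> lam A r D \<and> is_colimit (poset_cat r) A D X c \<longrightarrow>
      is_colimit (poset_cat r) B (comp_functor F D) (omap F X) (amap F \<circ> c))"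


section \<open>Generated objects\<close>

text \<open>
  The category of sets with elements of type \<open>'e\<close>.  A function is a triple of its domain, its
  graph as an extensional HOL function, and its codomain.  For the hom functors of a
  category with arrows in \<open>'m\<close> we take \<open>'e = 'm\<close>.  The choice does not affect which
  cocones on hom sets are colimits: a cocone of sets is a colimit as soon as it has
  the universal property with respect to a two-element set (and if \<open>'m\<close> has just one
  element, then the category has at most one arrow).
\<close>

definition set_cat :: "('e set, 'e set \<times> ('e \<Rightarrow> 'e) \<times> 'e set) cat" where
  "set_cat = \<lparr>Obj = UNIV,
    Arr = {(S, f, T). f \<in> S \<rightarrow>\<^sub>E T},
    Dom = (\<lambda>(S, f, T). S),
    Cod = (\<lambda>(S, f, T). T),
    Ident = (\<lambda>S. (S, restrict id S, S)),
    Comp = (\<lambda>(S', g, T') (S, f, T). (S, compose S g f, T'))\<rparr>"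

definition hom_functor :: "('o, 'm) cat \<Rightarrow> 'o \<Rightarrow>
    ('o, 'm, 'm set, 'm set \<times> ('m \<Rightarrow> 'm) \<times> 'm set) fnctr" where
  "hom_functor A G = \<lparr>omap = hom A G,
    amap = (\<lambda>f. (hom A G (Dom A f), restrict (Comp A f) (hom A G (Dom A f)),
      hom A G (Cod A f)))\<rparr>"

definition generated_obj :: "'u rel \<Rightarrow> 'l rel \<Rightarrow> ('o, 'm) cat \<Rightarrow> 'o \<Rightarrow> bool" where
  "generated_obj \<kappa> lam A G \<longleftrightarrow> G \<in> Obj A \<and>
    preserves_mono_colimits \<kappa> lam A set_cat (hom_functor A G)"

definition mono_generated :: "'u rel \<Rightarrow> 'l rel \<Rightarrow> ('o, 'm) cat \<Rightarrow> bool" where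
  "mono_generated \<kappa> lam A \<longleftrightarrow> category A \<and>
    (\<forall>X \<in> Obj A. \<exists>r D c. mono_diagram \<kappa> lam A r D \<and>
      (\<forall>p \<in> Obj (poset_cat r). generated_obj \<kappa> lam A (omap D p)) \<and>
      is_colimit (poset_cat r) A D X c)"


section \<open>Dense sets of spans\<close>

definition is_span :: "('o, 'm) cat \<Rightarrow> 'o \<Rightarrow> 'o \<Rightarrow> 'o \<times> 'm \<times> 'm \<Rightarrow> bool" where
  "is_span A X Y = (\<lambda>(U, x, y). monic A x \<and> monic A y \<and> x \<in> hom A U X \<and> y \<in> hom A U Y)"

definition dense_spans :: "'u rel \<Rightarrow> 'l rel \<Rightarrow> ('o, 'm) cat \<Rightarrow> 'o \<Rightarrow> 'o \<Rightarrow>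
    ('o \<times> 'm \<times> 'm) set \<Rightarrow> bool" where
  "dense_spans \<kappa> lam A X Y I \<longleftrightarrow> I \<noteq> {} \<and> (\<forall>i \<in> I. is_span A X Y i) \<and>
    (\<forall>(U, x, y) \<in> I. \<forall>G g. generated_obj \<kappa> lam A G \<and> monic A g \<and> g \<in> hom A G X \<longrightarrow>
      (\<exists>(U', x', y') \<in> I. \<exists>s \<in> hom A G U'. \<exists>w \<in> hom A U U'.
        Comp A x' s = g \<and> Comp A x' w = x \<and> Comp A y' w = y)) \<and>
    (\<forall>(U, x, y) \<in> I. \<forall>G g. generated_obj \<kappa> lam A G \<and> monic A g \<and> g \<in> hom A G Y \<longrightarrow>
      (\<exists>(U', x', y') \<in> I. \<exists>s \<in> hom A G U'. \<exists>w \<in> hom A U U'.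
        Comp A y' s = g \<and> Comp A x' w = x \<and> Comp A y' w = y))"

definition equivalent_objs :: "'u rel \<Rightarrow> 'l rel \<Rightarrow> ('o, 'm) cat \<Rightarrow> 'o \<Rightarrow> 'o \<Rightarrow> bool" where
  "equivalent_objs \<kappa> lam A X Y \<longleftrightarrow> (\<exists>I. |I| <o \<kappa> \<and> dense_spans \<kappa> lam A X Y I)"

end

theory Submission
  imports Defs
begin

text \<open>
  The witnessing set of spans between \<open>F X\<close> and \<open>F Y\<close> is the image under \<open>F\<close> of a dense set of
  spans between \<open>X\<close> and \<open>Y\<close>.  To check the back condition, take a \<open>\<lambda>\<close>-generated \<open>G\<close> in \<open>\<B>\<close>
  and \<open>g : G \<rightarrow> F X\<close>.  Write \<open>X\<close> as a colimit, with coprojections \<open>c\<^sub>p\<close>, of a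
  \<open>\<lambda>\<close>-directed diagram \<open>D\<close> of monomorphisms between \<open>\<lambda>\<close>-generated objects.
  Since \<open>F\<close> preserves this colimit and \<open>F \<circ> D\<close> consists of monomorphisms, \<open>g\<close> factors as
  \<open>g = F c\<^sub>p \<cdot> h\<close> for some \<open>p\<close>
  (\<open>generated_obj_factorization\<close>).  Were \<open>c\<^sub>p\<close> monic, the back condition in \<open>\<A>\<close> could be applied
  to \<open>c\<^sub>p\<close> itself: it yields \<open>s\<close> and a span \<open>(U', x', y')\<close> with \<open>x' \<cdot> s = c\<^sub>p\<close>, whence
  \<open>F x' \<cdot> (F s \<cdot> h) = g\<close>.  The forth condition is the back condition of the reversed spans.

  The crux is therefore that each \<open>c\<^sub>p\<close> is monic (\<open>coprojection_monic\<close>).  In an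
  arbitrary category this may fail.  In a mono-generated one, the
  \<open>\<lambda>\<close>-generated objects detect equality of parallel morphisms, because every object is a colimit of
  them; and for a \<open>\<lambda>\<close>-generated \<open>E\<close> the functor \<open>hom(E, -)\<close> turns the colimit into a directed
  colimit of sets and injections, whose coprojections are injective.
\<close>

section \<open>Functors and colimits\<close>

lemma hom_in_Obj:
  assumes "category C" "f \<in> hom C X Y"
  shows "X \<in> Obj C" "Y \<in> Obj C"
  using assms category.Dom_in_Obj category.Cod_in_Obj unfolding hom_def by fastforce+

lemma is_functor_comp:
  assumes "is_functor C D F" "is_functor D E G"
  shows "is_functor C E (comp_functor G F)"
proof -
  interpret F: is_functor C D F by fact
  interpret G: is_functor D E G by fact
  show ?thesis
  proof unfold_locales
    fix X assume "X \<in> Obj C"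
    then show "omap (comp_functor G F) X \<in> Obj E"
      "amap (comp_functor G F) (Ident C X) = Ident E (omap (comp_functor G F) X)"
      by (auto simp: comp_functor_def F.omap_in_Obj G.omap_in_Obj F.amap_Ident G.amap_Ident)
  next
    fix f X Y assume "f \<in> hom C X Y"
    then show "amap (comp_functor G F) f \<in>
        hom E (omap (comp_functor G F) X) (omap (comp_functor G F) Y)"
      by (simp add: comp_functor_def F.amap_in_hom G.amap_in_hom)
  next
    fix f g X Y Z assume f: "f \<in> hom C X Y" and g: "g \<in> hom C Y Z"
    show "amap (comp_functor G F) (Comp C g f) =
        Comp E (amap (comp_functor G F) g) (amap (comp_functor G F) f)"
      using G.amap_Comp[OF F.amap_in_hom[OF f] F.amap_in_hom[OF g]]
      by (simp add: comp_functor_def F.amap_Comp[OF f g])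
  qed
qed

lemma cocone_comp:
  assumes "is_functor J C D" "is_cocone J C D X c" "u \<in> hom C X Y"
  shows "is_cocone J C D Y (\<lambda>j. Comp C u (c j))"
proof -
  interpret is_functor J C D by fact
  have "Comp C (Comp C u (c (Cod J a))) (amap D a) = Comp C u (c (Dom J a))" if a: "a \<in> Arr J" for a
  proof -
    have "amap D a \<in> hom C (omap D (Dom J a)) (omap D (Cod J a))"
      using amap_in_hom a by (simp add: hom_def)
    moreover have "c (Cod J a) \<in> hom C (omap D (Cod J a)) X"
      using assms(2) dom.Cod_in_Obj[OF a] by (simp add: is_cocone_def)
    ultimately show ?thesis
      using cod.Comp_assoc[OF _ _ assms(3)] assms(2) a by (fastforce simp: is_cocone_def)
  qed
  moreover have "Comp C u (c j) \<in> hom C (omap D j) Y" if "j \<in> Obj J" for j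
    using assms(2,3) cod.Comp_in_hom that by (auto simp: is_cocone_def)
  moreover have "Y \<in> Obj C"
    using hom_in_Obj(2)[OF cod.category_axioms assms(3)] .
  ultimately show ?thesis
    by (simp add: is_cocone_def)
qed

lemma colimit_jointly_epic:
  assumes "is_functor J C D" "is_colimit J C D X c" "u \<in> hom C X Y" "v \<in> hom C X Y"
    and "\<And>j. j \<in> Obj J \<Longrightarrow> Comp C u (c j) = Comp C v (c j)"
  shows "u = v"
proof -
  have "is_cocone J C D Y (\<lambda>j. Comp C v (c j))"
    using cocone_comp[OF assms(1) _ assms(4)] assms(2) by (simp add: is_colimit_def)
  then have "\<exists>!h. h \<in> hom C X Y \<and> (\<forall>j \<in> Obj J. Comp C h (c j) = Comp C v (c j))"
    using assms(2) unfolding is_colimit_def by blast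
  moreover have "Comp C u (c j) = Comp C v (c j)" if "j \<in> Obj J" for j
    by (rule assms(5)[OF that])
  ultimately show ?thesis
    using assms(3,4) by blast
qed

section \<open>Directed posets\<close>

lemma regular_cardinal_finite_less:
  assumes "regular_cardinal lam" "finite S"
  shows "|S| <o lam"
  using assms
  by (intro Cfinite_ordLess_Cinfinite)
    (auto simp: regular_cardinal_def cfinite_def Field_card_of card_of_card_order_on)

lemma directed_poset_nonempty:
  assumes "regular_cardinal lam" "directed_poset lam r"
  shows "Field r \<noteq> {}"
proof -
  have "|{}| <o lam"
    by (rule regular_cardinal_finite_less[OF assms(1)]) simp
  then have "\<exists>u \<in> Field r. \<forall>s \<in> {}. (s, u) \<in> r"
    using assms(2) unfolding directed_poset_def by (metis empty_subsetI)
  then show ?thesis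
    by blast
qed

lemma directed_poset_upper_bound:
  assumes "regular_cardinal lam" "directed_poset lam r" "p \<in> Field r" "q \<in> Field r"
  obtains u where "(p, u) \<in> r" "(q, u) \<in> r"
proof -
  have "|{p, q}| <o lam" "{p, q} \<subseteq> Field r"
    using regular_cardinal_finite_less[OF assms(1), of "{p, q}"] assms(3,4) by simp_all
  then show ?thesis
    using assms(2) that unfolding directed_poset_def by (meson insertCI)
qed

lemma directed_poset_order:
  assumes "directed_poset lam r"
  shows "p \<in> Field r \<Longrightarrow> (p, p) \<in> r" "trans r"
  using assms
  by (auto simp: directed_poset_def partial_order_on_def preorder_on_def refl_on_def)

lemma poset_cat_simps [simp]:
  "Obj (poset_cat r) = Field r" "Arr (poset_cat r) = r"
  "Dom (poset_cat r) = fst" "Cod (poset_cat r) = snd"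
  "Comp (poset_cat r) b a = (fst a, snd b)"
  by (simp_all add: poset_cat_def)

lemma hom_poset_cat: "(p, q) \<in> r \<Longrightarrow> (p, q) \<in> hom (poset_cat r) p q"
  by (simp add: hom_def)

section \<open>Colimits of sets\<close>

definition fun_of :: "'e set \<times> ('e \<Rightarrow> 'e) \<times> 'e set \<Rightarrow> 'e \<Rightarrow> 'e" where
  "fun_of f = fst (snd f)"

lemma fun_of_triple [simp]: "fun_of (S, f, T) = f"
  by (simp add: fun_of_def)

lemma hom_set_cat: "f \<in> hom set_cat S T \<longleftrightarrow> (\<exists>\<phi> \<in> S \<rightarrow>\<^sub>E T. f = (S, \<phi>, T))"
  by (auto simp: hom_def set_cat_def)

lemma Comp_set_cat: "Comp set_cat (T, g, U) (S, f, T) = (S, compose S g f, U)"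
  by (simp add: set_cat_def)

lemma restrict_in_hom_set_cat: "\<phi> \<in> S \<rightarrow> T \<Longrightarrow> (S, restrict \<phi> S, T) \<in> hom set_cat S T"
  by (auto simp: hom_set_cat)

lemma fun_of_in: "f \<in> hom set_cat S T \<Longrightarrow> x \<in> S \<Longrightarrow> fun_of f x \<in> T"
  by (auto simp: hom_set_cat)

lemma fun_of_Comp:
  "f \<in> hom set_cat S T \<Longrightarrow> g \<in> hom set_cat T U \<Longrightarrow> x \<in> S \<Longrightarrow>
    fun_of (Comp set_cat g f) x = fun_of g (fun_of f x)"
  by (auto simp: hom_set_cat Comp_set_cat compose_def)

lemma set_cat_eqI:
  assumes "f \<in> hom set_cat S T" "g \<in> hom set_cat S T" "\<And>x. x \<in> S \<Longrightarrow> fun_of f x = fun_of g x"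
  shows "f = g"
proof -
  obtain \<phi> \<psi> where \<phi>: "\<phi> \<in> S \<rightarrow>\<^sub>E T" "f = (S, \<phi>, T)" and \<psi>: "\<psi> \<in> S \<rightarrow>\<^sub>E T" "g = (S, \<psi>, T)"
    using assms(1,2) by (auto simp: hom_set_cat)
  then have "\<phi> = \<psi>"
    using PiE_ext[OF \<phi>(1) \<psi>(1)] assms(3) by simp
  then show ?thesis
    using \<phi> \<psi> by simp
qed

lemma Comp_in_hom_set_cat:
  "f \<in> hom set_cat S T \<Longrightarrow> g \<in> hom set_cat T U \<Longrightarrow> Comp set_cat g f \<in> hom set_cat S U"
  by (auto simp: hom_set_cat Comp_set_cat compose_def PiE_iff)

lemma category_set_cat: "category (set_cat :: ('e set, 'e set \<times> ('e \<Rightarrow> 'e) \<times> 'e set) cat)"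
proof
  fix f :: "'e set \<times> ('e \<Rightarrow> 'e) \<times> 'e set"
  assume f: "f \<in> Arr set_cat"
  obtain S \<phi> T where "f = (S, \<phi>, T)" by (cases f)
  with f show "Comp set_cat f (Ident set_cat (Dom set_cat f)) = f"
    "Comp set_cat (Ident set_cat (Cod set_cat f)) f = f"
    by (auto simp: set_cat_def compose_def fun_eq_iff PiE_def Pi_def extensional_def)
next
  fix f g :: "'e set \<times> ('e \<Rightarrow> 'e) \<times> 'e set" and S T U
  assume "f \<in> hom set_cat S T" "g \<in> hom set_cat T U"
  then show "Comp set_cat g f \<in> hom set_cat S U"
    by (rule Comp_in_hom_set_cat)
next
  fix f g h :: "'e set \<times> ('e \<Rightarrow> 'e) \<times> 'e set" and S T U V
  assume "f \<in> hom set_cat S T" "g \<in> hom set_cat T U" "h \<in> hom set_cat U V"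
  then show "Comp set_cat h (Comp set_cat g f) = Comp set_cat (Comp set_cat h g) f"
    by (auto simp: hom_set_cat Comp_set_cat compose_def fun_eq_iff)
qed (auto simp: set_cat_def hom_def)

text \<open>
  If no coprojection reached \<open>z\<close>, then two maps that differ only at \<open>z\<close> would agree on all
  coprojections.  The element \<open>t\<close> ensures that there is room for two different values.
\<close>

lemma set_colimit_jointly_surjective:
  assumes "is_functor J set_cat D" "is_colimit J set_cat D S c" "z \<in> S" "t \<noteq> z"
  shows "\<exists>j \<in> Obj J. \<exists>x \<in> omap D j. fun_of (c j) x = z"
proof (rule ccontr)
  assume none: "\<not> ?thesis"
  define u where "u = (S, restrict (\<lambda>_. t) S, {z, t})"
  define v where "v = (S, restrict (\<lambda>y. if y = z then z else t) S, {z, t})"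
  have u: "u \<in> hom set_cat S {z, t}" and v: "v \<in> hom set_cat S {z, t}"
    unfolding u_def v_def by (rule restrict_in_hom_set_cat; simp)+
  have "Comp set_cat u (c j) = Comp set_cat v (c j)" if j: "j \<in> Obj J" for j
  proof -
    have c: "c j \<in> hom set_cat (omap D j) S"
      using assms(2) j by (simp add: is_colimit_def is_cocone_def)
    show ?thesis
    proof (rule set_cat_eqI)
      fix x assume x: "x \<in> omap D j"
      then have "fun_of (c j) x \<noteq> z"
        using none j by blast
      then show "fun_of (Comp set_cat u (c j)) x = fun_of (Comp set_cat v (c j)) x"
        using fun_of_in[OF c x]
        by (simp add: fun_of_Comp[OF c u x] fun_of_Comp[OF c v x]) (simp add: u_def v_def)
    qed (use Comp_in_hom_set_cat[OF c] u v in blast)+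
  qed
  then have "u = v"
    using colimit_jointly_epic[OF assms(1,2) u v] by blast
  then have "fun_of u z = fun_of v z"
    by simp
  then show False
    using assms(3,4) by (simp add: u_def v_def)
qed

text \<open>
  Two different elements \<open>a\<close>, \<open>b\<close> of the set at \<open>p\<close> are separated by a cocone with vertex \<open>{a, b}\<close>:
  send an element to \<open>a\<close> if it is eventually identified with \<open>a\<close>, and to \<open>b\<close> otherwise.
  Injectivity of the transition maps ensures that \<open>b\<close> itself is sent to \<open>b\<close>.
\<close>

lemma set_directed_colimit_injective:
  assumes lam: "regular_cardinal lam" and dir: "directed_poset lam r"
    and D: "is_functor (poset_cat r) set_cat D"
    and inj: "\<And>p q. (p, q) \<in> r \<Longrightarrow> inj_on (fun_of (amap D (p, q))) (omap D p)"
    and colim: "is_colimit (poset_cat r) set_cat D S c" and p: "p \<in> Field r"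
  shows "inj_on (fun_of (c p)) (omap D p)"
proof (rule inj_onI, rule ccontr)
  fix a b
  assume a: "a \<in> omap D p" and b: "b \<in> omap D p"
    and eq: "fun_of (c p) a = fun_of (c p) b" and ab: "a \<noteq> b"
  interpret D: is_functor "poset_cat r" set_cat D by fact
  define \<tau> where "\<tau> q s = fun_of (amap D (q, s))" for q s
  note order = directed_poset_order[OF dir]
  have \<tau>_arr: "amap D (q, s) \<in> hom set_cat (omap D q) (omap D s)" if "(q, s) \<in> r" for q s
    using D.amap_in_hom[OF hom_poset_cat[OF that]] .
  have \<tau>_in: "\<tau> q s z \<in> omap D s" if "(q, s) \<in> r" "z \<in> omap D q" for q s z
    using fun_of_in[OF \<tau>_arr] that by (simp add: \<tau>_def)
  have \<tau>_comp: "\<tau> s t (\<tau> q s z) = \<tau> q t z"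
    if "(q, s) \<in> r" "(s, t) \<in> r" "z \<in> omap D q" for q s t z
    using D.amap_Comp[OF hom_poset_cat[OF that(1)] hom_poset_cat[OF that(2)]]
      fun_of_Comp[OF \<tau>_arr[OF that(1)] \<tau>_arr[OF that(2)] that(3)]
    by (simp add: \<tau>_def)
  define meets where "meets q z \<longleftrightarrow> (\<exists>s. (q, s) \<in> r \<and> (p, s) \<in> r \<and> \<tau> q s z = \<tau> p s a)" for q z
  define d where "d q = (omap D q, restrict (\<lambda>z. if meets q z then a else b) (omap D q), {a, b})" for q
  have d_hom: "d q \<in> hom set_cat (omap D q) {a, b}" for q
    unfolding d_def by (rule restrict_in_hom_set_cat) simp
  have meets_\<tau>: "meets s (\<tau> q s z) \<longleftrightarrow> meets q z" if qs: "(q, s) \<in> r" and z: "z \<in> omap D q" for q s z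
  proof
    assume "meets s (\<tau> q s z)"
    then obtain t where t: "(s, t) \<in> r" "(p, t) \<in> r" "\<tau> s t (\<tau> q s z) = \<tau> p t a"
      unfolding meets_def by blast
    moreover have "(q, t) \<in> r"
      using qs t(1) order(2) by (meson transD)
    ultimately show "meets q z"
      unfolding meets_def using \<tau>_comp[OF qs t(1) z] by auto
  next
    assume "meets q z"
    then obtain t where t: "(q, t) \<in> r" "(p, t) \<in> r" "\<tau> q t z = \<tau> p t a"
      unfolding meets_def by blast
    obtain t' where t': "(s, t') \<in> r" "(t, t') \<in> r"
      using directed_poset_upper_bound[OF lam dir FieldI2[OF qs] FieldI2[OF t(1)]] .
    have "(p, t') \<in> r"
      using t(2) t'(2) order(2) by (meson transD)
    moreover have "\<tau> s t' (\<tau> q s z) = \<tau> p t' a"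
      using \<tau>_comp[OF qs t'(1) z] \<tau>_comp[OF t(1) t'(2) z] \<tau>_comp[OF t(2) t'(2) a] t(3) by simp
    ultimately show "meets s (\<tau> q s z)"
      unfolding meets_def using t'(1) by blast
  qed
  have "Comp set_cat (d s) (amap D (q, s)) = d q" if qs: "(q, s) \<in> r" for q s
  proof (rule set_cat_eqI)
    fix z assume z: "z \<in> omap D q"
    show "fun_of (Comp set_cat (d s) (amap D (q, s))) z = fun_of (d q) z"
      using fun_of_Comp[OF \<tau>_arr[OF qs] d_hom z] \<tau>_in[OF qs z] meets_\<tau>[OF qs z] z
      by (simp add: d_def \<tau>_def)
  qed (use Comp_in_hom_set_cat[OF \<tau>_arr[OF qs] d_hom] d_hom in blast)+
  then have "is_cocone (poset_cat r) set_cat D {a, b} d"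
    using d_hom by (auto simp: is_cocone_def set_cat_def)
  then have "\<exists>!h. h \<in> hom set_cat S {a, b} \<and> (\<forall>q \<in> Field r. Comp set_cat h (c q) = d q)"
    using colim by (simp add: is_colimit_def)
  then obtain h where h: "h \<in> hom set_cat S {a, b}" "Comp set_cat h (c p) = d p"
    using p by blast
  have c: "c p \<in> hom set_cat (omap D p) S"
    using colim p by (simp add: is_colimit_def is_cocone_def)
  have "fun_of (d p) a = fun_of (d p) b"
    using fun_of_Comp[OF c h(1) a] fun_of_Comp[OF c h(1) b] eq h(2) by simp
  moreover have "meets p a"
    unfolding meets_def using order(1)[OF p] by blast
  moreover have "\<not> meets p b"
    using inj a b ab unfolding meets_def \<tau>_def by (metis inj_onD)
  ultimately show False
    using a b ab by (simp add: d_def)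
qed

section \<open>Generated objects and directed colimits of monomorphisms\<close>

lemma hom_functor_is_functor:
  assumes "category A"
  shows "is_functor A set_cat (hom_functor A G)"
proof -
  interpret category A by fact
  have amap: "amap (hom_functor A G) f = (hom A G X, restrict (Comp A f) (hom A G X), hom A G Y)"
    if "f \<in> hom A X Y" for f X Y
    using that by (simp add: hom_functor_def hom_def)
  interpret S: category set_cat by (rule category_set_cat)
  show ?thesis
  proof unfold_locales
    fix X assume X: "X \<in> Obj A"
    show "omap (hom_functor A G) X \<in> Obj set_cat"
      by (simp add: set_cat_def)
    have "restrict (Comp A (Ident A X)) (hom A G X) = restrict id (hom A G X)"
      using Ident_Comp by (fastforce simp: restrict_def hom_def)
    then show "amap (hom_functor A G) (Ident A X) = Ident set_cat (omap (hom_functor A G) X)"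
      using amap[OF Ident_in_hom[OF X]] by (simp add: set_cat_def hom_functor_def)
  next
    fix f X Y assume f: "f \<in> hom A X Y"
    show "amap (hom_functor A G) f \<in>
        hom set_cat (omap (hom_functor A G) X) (omap (hom_functor A G) Y)"
      unfolding amap[OF f] using Comp_in_hom f
      by (simp add: hom_functor_def) (blast intro: restrict_in_hom_set_cat)
  next
    fix f g X Y Z assume f: "f \<in> hom A X Y" and g: "g \<in> hom A Y Z"
    have "Comp A (Comp A g f) k = Comp A g (Comp A f k)" if "k \<in> hom A G X" for k
      using Comp_assoc[OF that f g] by simp
    then have "restrict (Comp A (Comp A g f)) (hom A G X) =
        compose (hom A G X) (restrict (Comp A g) (hom A G Y)) (restrict (Comp A f) (hom A G X))"
      using Comp_in_hom[OF _ f] by (auto simp: compose_def restrict_def)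
    then show "amap (hom_functor A G) (Comp A g f) =
        Comp set_cat (amap (hom_functor A G) g) (amap (hom_functor A G) f)"
      unfolding amap[OF f] amap[OF g] amap[OF Comp_in_hom[OF f g]] Comp_set_cat by simp
  qed
qed

lemma fun_of_hom_functor:
  assumes "f \<in> hom A X Y" "k \<in> hom A G X"
  shows "fun_of (amap (hom_functor A G) f) k = Comp A f k"
  using assms by (auto simp: hom_functor_def hom_def)

lemma mono_diagramD:
  assumes "mono_diagram \<kappa> lam A r D"
  shows "directed_poset lam r" "is_functor (poset_cat r) A D" "category A"
    and "(p, q) \<in> r \<Longrightarrow> monic A (amap D (p, q))"
    and "(p, q) \<in> r \<Longrightarrow> amap D (p, q) \<in> hom A (omap D p) (omap D q)"
proof -
  show D: "is_functor (poset_cat r) A D" and "directed_poset lam r"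
    using assms by (simp_all add: mono_diagram_def)
  show "category A"
    using D by (simp add: is_functor_def)
  show "monic A (amap D (p, q))" if "(p, q) \<in> r"
    using assms that by (simp add: mono_diagram_def)
  show "amap D (p, q) \<in> hom A (omap D p) (omap D q)" if "(p, q) \<in> r"
    using is_functor.amap_in_hom[OF D hom_poset_cat[OF that]] .
qed

lemma mono_diagram_comp:
  assumes "mono_diagram \<kappa> lam A r D" "is_functor A B F" "preserves_monos A B F"
  shows "mono_diagram \<kappa> lam B r (comp_functor F D)"
  using assms is_functor_comp[of "poset_cat r" A D B F]
  by (auto simp: mono_diagram_def preserves_monos_def comp_functor_def)

lemma monic_cancel:
  assumes "category A" "monic A f" "f \<in> hom A X Y" "u \<in> hom A T X" "v \<in> hom A T X"
    and "Comp A f u = Comp A f v"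
  shows "u = v"
  using assms hom_in_Obj(1)[OF assms(1,4)] by (auto simp: monic_def hom_def)

lemma colimit_coprojection:
  assumes "is_colimit (poset_cat r) A D X c" "p \<in> Field r"
  shows "c p \<in> hom A (omap D p) X"
  using assms by (simp add: is_colimit_def is_cocone_def)

lemma generated_obj_colimit:
  assumes "generated_obj \<kappa> lam A G" "mono_diagram \<kappa> lam A r D"
    and "is_colimit (poset_cat r) A D X c"
  shows "is_functor (poset_cat r) set_cat (comp_functor (hom_functor A G) D)"
    and "is_colimit (poset_cat r) set_cat (comp_functor (hom_functor A G) D)
      (hom A G X) (amap (hom_functor A G) \<circ> c)"
proof -
  show "is_functor (poset_cat r) set_cat (comp_functor (hom_functor A G) D)"
    using is_functor_comp[OF mono_diagramD(2)[OF assms(2)]]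
      hom_functor_is_functor[OF mono_diagramD(3)[OF assms(2)]] by blast
  have "is_colimit (poset_cat r) set_cat (comp_functor (hom_functor A G) D)
      (omap (hom_functor A G) X) (amap (hom_functor A G) \<circ> c)"
    using assms unfolding generated_obj_def preserves_mono_colimits_def by blast
  then show "is_colimit (poset_cat r) set_cat (comp_functor (hom_functor A G) D)
      (hom A G X) (amap (hom_functor A G) \<circ> c)"
    by (simp add: hom_functor_def)
qed

lemma generated_obj_factorization:
  assumes lam: "regular_cardinal lam" and G: "generated_obj \<kappa> lam A G"
    and D: "mono_diagram \<kappa> lam A r D" and colim: "is_colimit (poset_cat r) A D X c"
    and g: "g \<in> hom A G X"
  obtains p h where "p \<in> Field r" "h \<in> hom A G (omap D p)" "Comp A (c p) h = g"
proof -
  interpret category A by (rule mono_diagramD(3)[OF D])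
  obtain p where p: "p \<in> Field r"
    using directed_poset_nonempty[OF lam mono_diagramD(1)[OF D]] by blast
  note c = colimit_coprojection[OF colim]
  show thesis
  proof (cases "c p = g")
    case True
    \<comment> \<open>If \<open>c p = g\<close>, then there may be no arrow other than \<open>g\<close>, so surjectivity cannot be tested on a
      two-element set of arrows; but then \<open>g\<close> trivially factors through the identity of \<open>G\<close>.\<close>
    then have G_eq: "omap D p = G"
      using c[OF p] g by (simp add: hom_def)
    have "Ident A G \<in> hom A G G"
      using G by (simp add: Ident_in_hom generated_obj_def)
    moreover have "Comp A g (Ident A G) = g"
      using Comp_Ident[of g] g by (simp add: hom_def)
    ultimately show ?thesis
      using that[OF p] G_eq True by simp
  next
    case False
    obtain j x where j: "j \<in> Field r" and x: "x \<in> hom A G (omap D j)"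
      and eq: "fun_of (amap (hom_functor A G) (c j)) x = g"
      using set_colimit_jointly_surjective[OF generated_obj_colimit[OF G D colim] g False]
      by (auto simp: comp_functor_def hom_functor_def)
    show ?thesis
      using that[OF j x] eq fun_of_hom_functor[OF c[OF j] x] by simp
  qed
qed

lemma generated_obj_cancel_coprojection:
  assumes lam: "regular_cardinal lam" and E: "generated_obj \<kappa> lam A E"
    and D: "mono_diagram \<kappa> lam A r D" and colim: "is_colimit (poset_cat r) A D X c"
    and p: "p \<in> Field r" and u: "u \<in> hom A E (omap D p)" and v: "v \<in> hom A E (omap D p)"
    and eq: "Comp A (c p) u = Comp A (c p) v"
  shows "u = v"
proof -
  let ?HD = "comp_functor (hom_functor A E) D"
  have omap: "omap ?HD q = hom A E (omap D q)" for q
    by (simp add: comp_functor_def hom_functor_def)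
  have inj: "inj_on (fun_of (amap ?HD (q, s))) (omap ?HD q)" if qs: "(q, s) \<in> r" for q s
  proof (rule inj_onI, unfold omap)
    fix k l
    assume k: "k \<in> hom A E (omap D q)" and l: "l \<in> hom A E (omap D q)"
      and "fun_of (amap ?HD (q, s)) k = fun_of (amap ?HD (q, s)) l"
    then have "Comp A (amap D (q, s)) k = Comp A (amap D (q, s)) l"
      using fun_of_hom_functor[OF mono_diagramD(5)[OF D qs]] by (simp add: comp_functor_def)
    then show "k = l"
      using monic_cancel[OF mono_diagramD(3)[OF D] mono_diagramD(4,5)[OF D qs] k l] by blast
  qed
  have "inj_on (fun_of (amap (hom_functor A E) (c p))) (omap ?HD p)"
    using set_directed_colimit_injective[OF lam mono_diagramD(1)[OF D]
        generated_obj_colimit(1)[OF E D colim] inj generated_obj_colimit(2)[OF E D colim] p]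
    by simp
  then show ?thesis
    using u v eq fun_of_hom_functor[OF colimit_coprojection[OF colim p]]
    by (simp add: omap inj_on_def)
qed

text \<open>
  Test monicity of \<open>c p\<close> on \<open>u, v : T \<rightarrow> D p\<close>.  Writing \<open>T\<close> itself as a colimit of generated
  objects reduces \<open>u = v\<close> to the equality of their composites with each coprojection of \<open>T\<close>, whose
  domain is generated, so that \<open>c p\<close> can be cancelled.
\<close>

lemma coprojection_monic:
  assumes lam: "regular_cardinal lam" and A: "mono_generated \<kappa> lam A"
    and D: "mono_diagram \<kappa> lam A r D" and colim: "is_colimit (poset_cat r) A D X c"
    and p: "p \<in> Field r"
  shows "monic A (c p)"
proof -
  interpret category A using A by (simp add: mono_generated_def)
  note c = colimit_coprojection[OF colim p]
  have "u = v" if T: "T \<in> Obj A" and u: "u \<in> hom A T (omap D p)" and v: "v \<in> hom A T (omap D p)"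
    and eq: "Comp A (c p) u = Comp A (c p) v" for T u v
  proof -
    obtain r' E e where E: "mono_diagram \<kappa> lam A r' E"
      and gen: "\<And>q. q \<in> Field r' \<Longrightarrow> generated_obj \<kappa> lam A (omap E q)"
      and e: "is_colimit (poset_cat r') A E T e"
      using A T unfolding mono_generated_def poset_cat_simps by blast
    have "Comp A u (e q) = Comp A v (e q)" if q: "q \<in> Field r'" for q
    proof (rule generated_obj_cancel_coprojection[OF lam gen[OF q] D colim p])
      note eq_hom = colimit_coprojection[OF e q]
      show "Comp A u (e q) \<in> hom A (omap E q) (omap D p)" "Comp A v (e q) \<in> hom A (omap E q) (omap D p)"
        using Comp_in_hom[OF eq_hom] u v by blast+
      show "Comp A (c p) (Comp A u (e q)) = Comp A (c p) (Comp A v (e q))"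
        using Comp_assoc[OF eq_hom u c] Comp_assoc[OF eq_hom v c] eq by simp
    qed
    then show "u = v"
      using colimit_jointly_epic[OF mono_diagramD(2)[OF E] e u v] by simp
  qed
  then show ?thesis
    using c by (auto simp: monic_def hom_def)
qed

section \<open>Dense sets of spans\<close>

text \<open>
  A map out of a generated object into \<open>F X\<close> only sees the part \<open>F (D p)\<close>, for a generated
  subobject \<open>D p\<close> of \<open>X\<close>.  This is what lets the extension property in \<open>\<A>\<close> be used in \<open>\<B>\<close>.
\<close>

lemma generated_subobject_factorization:
  assumes lam: "regular_cardinal lam" and A: "mono_generated \<kappa> lam A"
    and F: "is_functor A B F" "preserves_monos A B F" "preserves_mono_colimits \<kappa> lam A B F"
    and X: "X \<in> Obj A" and G: "generated_obj \<kappa> lam B G" and g: "g \<in> hom B G (omap F X)"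
  obtains E m h where "generated_obj \<kappa> lam A E" "monic A m" "m \<in> hom A E X"
    "h \<in> hom B G (omap F E)" "Comp B (amap F m) h = g"
proof -
  obtain r D c where D: "mono_diagram \<kappa> lam A r D"
    and gen: "\<And>q. q \<in> Field r \<Longrightarrow> generated_obj \<kappa> lam A (omap D q)"
    and c: "is_colimit (poset_cat r) A D X c"
    using A X unfolding mono_generated_def poset_cat_simps by blast
  have Fc: "is_colimit (poset_cat r) B (comp_functor F D) (omap F X) (amap F \<circ> c)"
    using F(3) D c unfolding preserves_mono_colimits_def by blast
  obtain p h where "p \<in> Field r" "h \<in> hom B G (omap (comp_functor F D) p)"
      "Comp B ((amap F \<circ> c) p) h = g"
    by (rule generated_obj_factorization[OF lam G mono_diagram_comp[OF D F(1,2)] Fc g])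
  then have "p \<in> Field r" "h \<in> hom B G (omap F (omap D p))" "Comp B (amap F (c p)) h = g"
    by (simp_all add: comp_functor_def)
  then show thesis
    using that gen coprojection_monic[OF lam A D c] colimit_coprojection[OF c] by blast
qed

definition reverse_span :: "'o \<times> 'm \<times> 'm \<Rightarrow> 'o \<times> 'm \<times> 'm" where
  "reverse_span = (\<lambda>(U, x, y). (U, y, x))"

definition image_span :: "('o, 'm, 'p, 'n) fnctr \<Rightarrow> 'o \<times> 'm \<times> 'm \<Rightarrow> 'p \<times> 'n \<times> 'n" where
  "image_span F = (\<lambda>(U, x, y). (omap F U, amap F x, amap F y))"

definition back_condition :: "'u rel \<Rightarrow> 'l rel \<Rightarrow> ('o, 'm) cat \<Rightarrow> 'o \<Rightarrow> ('o \<times> 'm \<times> 'm) set \<Rightarrow> bool" where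
  "back_condition \<kappa> lam A X I \<longleftrightarrow>
    (\<forall>(U, x, y) \<in> I. \<forall>G g. generated_obj \<kappa> lam A G \<and> monic A g \<and> g \<in> hom A G X \<longrightarrow>
      (\<exists>(U', x', y') \<in> I. \<exists>s \<in> hom A G U'. \<exists>w \<in> hom A U U'.
        Comp A x' s = g \<and> Comp A x' w = x \<and> Comp A y' w = y))"

lemma dense_spans_iff_back:
  "dense_spans \<kappa> lam A X Y I \<longleftrightarrow> I \<noteq> {} \<and> (\<forall>i \<in> I. is_span A X Y i) \<and>
    back_condition \<kappa> lam A X I \<and> back_condition \<kappa> lam A Y (reverse_span ` I)"
proof -
  have "back_condition \<kappa> lam A Y (reverse_span ` I) \<longleftrightarrow>
    (\<forall>(U, x, y) \<in> I. \<forall>G g. generated_obj \<kappa> lam A G \<and> monic A g \<and> g \<in> hom A G Y \<longrightarrow>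
      (\<exists>(U', x', y') \<in> I. \<exists>s \<in> hom A G U'. \<exists>w \<in> hom A U U'.
        Comp A y' s = g \<and> Comp A x' w = x \<and> Comp A y' w = y))"
    by (simp add: back_condition_def reverse_span_def split_beta conj_ac)
  then show ?thesis
    unfolding dense_spans_def back_condition_def[of \<kappa> lam A X I] by argo
qed

lemma is_span_reverse: "is_span A X Y i \<Longrightarrow> is_span A Y X (reverse_span i)"
  by (auto simp: is_span_def reverse_span_def)

lemma is_span_image:
  assumes "is_functor A B F" "preserves_monos A B F" "is_span A X Y i"
  shows "is_span B (omap F X) (omap F Y) (image_span F i)"
  using assms is_functor.amap_in_hom[OF assms(1)]
  by (auto simp: is_span_def image_span_def preserves_monos_def)

lemma back_condition_image:
  assumes lam: "regular_cardinal lam" and A: "mono_generated \<kappa> lam A"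
    and F: "is_functor A B F" "preserves_monos A B F" "preserves_mono_colimits \<kappa> lam A B F"
    and X: "X \<in> Obj A" and spans: "\<And>i. i \<in> I \<Longrightarrow> is_span A X Y i"
    and I_back: "back_condition \<kappa> lam A X I"
  shows "back_condition \<kappa> lam B (omap F X) (image_span F ` I)"
proof -
  interpret F: is_functor A B F by fact
  have "\<exists>(U', x', y') \<in> image_span F ` I. \<exists>s \<in> hom B G U'. \<exists>w \<in> hom B (omap F U) U'.
      Comp B x' s = g \<and> Comp B x' w = amap F x \<and> Comp B y' w = amap F y"
    if i: "(U, x, y) \<in> I" and G: "generated_obj \<kappa> lam B G" and g: "g \<in> hom B G (omap F X)"
    for U x y G g
  proof -
    obtain E m h where E: "generated_obj \<kappa> lam A E" "monic A m" "m \<in> hom A E X"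
      and h: "h \<in> hom B G (omap F E)" "Comp B (amap F m) h = g"
      by (rule generated_subobject_factorization[OF lam A F X G g])
    then obtain U' x' y' s w where j: "(U', x', y') \<in> I"
      and s: "s \<in> hom A E U'" and w: "w \<in> hom A U U'"
      and eqs: "Comp A x' s = m" "Comp A x' w = x" "Comp A y' w = y"
      using I_back i unfolding back_condition_def by blast
    have x': "x' \<in> hom A U' X" and y': "y' \<in> hom A U' Y"
      using spans[OF j] by (auto simp: is_span_def)
    have Fs: "Comp B (amap F s) h \<in> hom B G (omap F U')"
      using F.cod.Comp_in_hom[OF h(1) F.amap_in_hom[OF s]] .
    have "Comp B (amap F x') (Comp B (amap F s) h) = g"
      using F.cod.Comp_assoc[OF h(1) F.amap_in_hom[OF s] F.amap_in_hom[OF x']]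
        F.amap_Comp[OF s x'] eqs(1) h(2) by simp
    moreover have "Comp B (amap F x') (amap F w) = amap F x" "Comp B (amap F y') (amap F w) = amap F y"
      using F.amap_Comp[OF w x'] F.amap_Comp[OF w y'] eqs(2,3) by simp_all
    moreover have "(omap F U', amap F x', amap F y') \<in> image_span F ` I"
      using j by (force simp: image_span_def)
    ultimately show ?thesis
      using Fs F.amap_in_hom[OF w] by blast
  qed
  then show ?thesis
    unfolding back_condition_def by (auto simp: image_span_def)
qed

theorem proposition2p14:
  fixes \<kappa> :: "'u rel" and lam :: "'l rel"
    and A :: "('o, 'm) cat" and B :: "('p, 'n) cat"
    and F :: "('o, 'm, 'p, 'n) fnctr"
  assumes "Card_order \<kappa>"
    and "regular_cardinal lam"
    and "mono_generated \<kappa> lam A"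
    and "category B"
    and "is_functor A B F"
    and "preserves_monos A B F"
    and "preserves_mono_colimits \<kappa> lam A B F"
    and "X \<in> Obj A" and "Y \<in> Obj A"
    and "equivalent_objs \<kappa> lam A X Y"
  shows "equivalent_objs \<kappa> lam B (omap F X) (omap F Y)"
proof -
  obtain I where small: "|I| <o \<kappa>" and dense: "dense_spans \<kappa> lam A X Y I"
    using assms(10) unfolding equivalent_objs_def by blast
  have spans: "\<And>i. i \<in> I \<Longrightarrow> is_span A X Y i"
    using dense by (simp add: dense_spans_def)
  then have reversed: "\<And>i. i \<in> reverse_span ` I \<Longrightarrow> is_span A Y X i"
    by (metis imageE is_span_reverse)
  have FX_back: "back_condition \<kappa> lam B (omap F X) (image_span F ` I)"
    using back_condition_image[OF assms(2,3,5-7,8) spans] dense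
    by (simp add: dense_spans_iff_back)
  have "back_condition \<kappa> lam B (omap F Y) (image_span F ` reverse_span ` I)"
    using back_condition_image[OF assms(2,3,5-7,9) reversed] dense
    by (simp add: dense_spans_iff_back)
  moreover have "image_span F ` reverse_span ` I = reverse_span ` image_span F ` I"
    by (simp add: image_image image_span_def reverse_span_def split_beta)
  moreover have "\<forall>j \<in> image_span F ` I. is_span B (omap F X) (omap F Y) j"
    using is_span_image[OF assms(5,6) spans] by blast
  moreover have "image_span F ` I \<noteq> {}"
    using dense by (simp add: dense_spans_def)
  ultimately have "dense_spans \<kappa> lam B (omap F X) (omap F Y) (image_span F ` I)"
    using FX_back by (simp only: dense_spans_iff_back simp_thms)
  moreover have "|image_span F ` I| <o \<kappa>"
    using card_of_image small by (rule ordLeq_ordLess_trans)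
  ultimately show ?thesis
    unfolding equivalent_objs_def by blast
qed

end
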